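(* Let $p$ be an odd prime and $m>0$ an integer such that $q=p^m>3$. Let $\mathcal{S}=\mathrm{SL}(2,q)$ and let $A$ and $B$ be matrices in $\mathcal{S}$. Then exactly one of the following holds: (i) $A^{\mathcal{S}}B^{\mathcal{S}}=(AB)^{\mathcal{S}}$ and at least one of $A$, $B$ is a scalar matrix. (ii) $A^{\mathcal{S}}B^{\mathcal{S}}$ is the union of at least $\frac{q+3}{2}$ distinct conjugacy classes of $\mathcal{S}$, i.e. $\eta(A^{\mathcal{S}}B^{\mathcal{S}})\ge\frac{q+3}{2}$.
   Context: $\mathrm{SL}(2,q)$ is the group of $2\times 2$ matrices of determinant $1$ over the finite field with $q$ elements. For a finite group $\mathcal{G}$ and $A\in\mathcal{G}$, $A^{\mathcal{G}}=\{B^{-1}AB\mid B\in\mathcal{G}\}$ is the conjugacy class of $A$. The product of two classes is $A^{\mathcal{G}}B^{\mathcal{G}}=\{XY\mid X\in A^{\mathcal{G}},\,Y\in B^{\mathcal{G}}\}$. This set is invariant under conjugation, hence a union of distinct conjugacy classes. For a conjugation-invariant subset $\mathcal{X}$ of $\mathcal{G}$, $\eta(\mathcal{X})$ denotes the number of distinct conjugacy classes of $\mathcal{G}$ whose union is $\mathcal{X}$. *)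

theory Defs
  imports
    "HOL-Analysis.Determinants"
    "HOL-Computational_Algebra.Primes"
    "HOL-Algebra.Coset"
begin

definition SL2 :: "('a::field ^ 2 ^ 2) monoid" where
  "SL2 = \<lparr>carrier = {A. det A = 1}, mult = (**), one = mat 1\<rparr>"

definition conj_class :: "('g, 'b) monoid_scheme \<Rightarrow> 'g \<Rightarrow> 'g set" where
  "conj_class G a = {inv\<^bsub>G\<^esub> b \<otimes>\<^bsub>G\<^esub> a \<otimes>\<^bsub>G\<^esub> b | b. b \<in> carrier G}"

definition conj_classes :: "('g, 'b) monoid_scheme \<Rightarrow> 'g set set" where
  "conj_classes G = conj_class G ` carrier G"

definition conj_invariant :: "('g, 'b) monoid_scheme \<Rightarrow> 'g set \<Rightarrow> bool" where
  "conj_invariant G X \<longleftrightarrow> X \<subseteq> carrier G \<and> (\<forall>x\<in>X. conj_class G x \<subseteq> X)"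

text \<open>
  The definite description is meaningful only for conjugation-invariant sets; for those,
  existence and uniqueness of the family \<open>F\<close> are shown below.
\<close>

definition eta :: "('g, 'b) monoid_scheme \<Rightarrow> 'g set \<Rightarrow> nat" where
  "eta G X = card (THE F. F \<subseteq> conj_classes G \<and> \<Union>F = X)"

lemma group_SL2: "group (SL2 :: ('a::field ^ 2 ^ 2) monoid)"
proof (rule groupI)
  fix A :: "'a ^ 2 ^ 2"
  assume "A \<in> carrier SL2"
  then have d: "det A = 1"
    by (simp add: SL2_def)
  then obtain B where B: "B ** A = mat 1"
    using invertible_det_nz[of A] unfolding invertible_def by auto
  then have "det B * det A = 1"
    by (metis det_mul det_I)
  with d B show "\<exists>B\<in>carrier SL2. B \<otimes>\<^bsub>SL2\<^esub> A = \<one>\<^bsub>SL2\<^esub>"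
    by (auto simp: SL2_def)
qed (auto simp: SL2_def det_mul matrix_mul_assoc)

context group
begin

lemma conj_class_self:
  assumes "a \<in> carrier G"
  shows "a \<in> conj_class G a"
  unfolding conj_class_def using assms by (auto intro!: exI[of _ \<one>])

lemma conj_class_closed:
  assumes "a \<in> carrier G"
  shows "conj_class G a \<subseteq> carrier G"
  unfolding conj_class_def using assms by auto

lemma conj_class_mono:
  assumes a: "a \<in> carrier G" and x: "x \<in> conj_class G a"
  shows "conj_class G x \<subseteq> conj_class G a"
proof
  fix y assume "y \<in> conj_class G x"
  then obtain c where c: "c \<in> carrier G" "y = inv c \<otimes> x \<otimes> c"
    by (auto simp: conj_class_def)
  from x obtain b where b: "b \<in> carrier G" "x = inv b \<otimes> a \<otimes> b"
    by (auto simp: conj_class_def)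
  have "y = inv (b \<otimes> c) \<otimes> a \<otimes> (b \<otimes> c)"
    using a b c by (simp add: inv_mult_group m_assoc)
  with b c show "y \<in> conj_class G a"
    unfolding conj_class_def by blast
qed

lemma conj_class_sym:
  assumes a: "a \<in> carrier G" and x: "x \<in> conj_class G a"
  shows "a \<in> conj_class G x"
proof -
  from x obtain b where b: "b \<in> carrier G" "x = inv b \<otimes> a \<otimes> b"
    by (auto simp: conj_class_def)
  have "b \<otimes> (inv b \<otimes> a) = a"
    using a b(1) by (simp flip: m_assoc)
  then have "a = inv (inv b) \<otimes> x \<otimes> inv b"
    using a b by (simp add: m_assoc)
  with b show ?thesis
    unfolding conj_class_def by blast
qed

lemma conj_class_eq:
  assumes "a \<in> carrier G" "x \<in> conj_class G a"
  shows "conj_class G x = conj_class G a"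
proof -
  have "x \<in> carrier G"
    using conj_class_closed assms by blast
  then show ?thesis
    using conj_class_mono[OF assms] conj_class_mono[OF _ conj_class_sym[OF assms]] by blast
qed

lemma conj_invariant_class_family_iff:
  assumes X: "conj_invariant G X"
  shows "F \<subseteq> conj_classes G \<and> \<Union>F = X \<longleftrightarrow> F = conj_class G ` X"
proof
  assume F: "F \<subseteq> conj_classes G \<and> \<Union>F = X"
  have rep: "\<exists>a\<in>carrier G. C = conj_class G a" if "C \<in> F" for C
    using that F by (auto simp: conj_classes_def)
  have eq: "C = conj_class G x" if "C \<in> F" "x \<in> C" for C x
    using rep[OF that(1)] that(2) conj_class_eq by metis
  have ne: "\<exists>x. x \<in> C" if "C \<in> F" for C
    using rep[OF that] conj_class_self by metis
  show "F = conj_class G ` X"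
  proof (intro equalityI subsetI)
    fix C assume C: "C \<in> F"
    then obtain x where "x \<in> C"
      using ne by blast
    with C F have "x \<in> X"
      by blast
    then show "C \<in> conj_class G ` X"
      using eq[OF C \<open>x \<in> C\<close>] by blast
  next
    fix C assume "C \<in> conj_class G ` X"
    then obtain x where x: "x \<in> X" "C = conj_class G x"
      by blast
    with F obtain D where D: "D \<in> F" "x \<in> D"
      by blast
    with x eq[OF D] show "C \<in> F"
      by simp
  qed
next
  assume F: "F = conj_class G ` X"
  have sub: "X \<subseteq> carrier G" and inv: "\<And>x. x \<in> X \<Longrightarrow> conj_class G x \<subseteq> X"
    using X by (auto simp: conj_invariant_def)
  have "x \<in> conj_class G x" if "x \<in> X" for x
    using that sub conj_class_self by blast
  then have "\<Union>F = X"
    unfolding F using inv by blast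
  moreover have "F \<subseteq> conj_classes G"
    unfolding F conj_classes_def using sub by (rule image_mono)
  ultimately show "F \<subseteq> conj_classes G \<and> \<Union>F = X"
    by blast
qed

lemma eta_eq:
  assumes "conj_invariant G X"
  shows "eta G X = card (conj_class G ` X)"
  unfolding eta_def conj_invariant_class_family_iff[OF assms] by simp

lemma conj_invariant_set_mult:
  assumes a: "a \<in> carrier G" and b: "b \<in> carrier G"
  shows "conj_invariant G (conj_class G a <#> conj_class G b)"
  unfolding conj_invariant_def
proof (intro conjI ballI subsetI)
  fix z assume "z \<in> conj_class G a <#> conj_class G b"
  then show "z \<in> carrier G"
    using set_mult_closed[OF conj_class_closed[OF a] conj_class_closed[OF b]] by blast
next
  fix z w assume z: "z \<in> conj_class G a <#> conj_class G b" and w: "w \<in> conj_class G z"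
  from z obtain x y where xy: "x \<in> conj_class G a" "y \<in> conj_class G b" "z = x \<otimes> y"
    by (auto simp: set_mult_def)
  from w obtain c where c: "c \<in> carrier G" "w = inv c \<otimes> z \<otimes> c"
    by (auto simp: conj_class_def)
  have carr: "x \<in> carrier G" "y \<in> carrier G"
    using xy conj_class_closed a b by blast+
  have "c \<otimes> (inv c \<otimes> (y \<otimes> c)) = y \<otimes> c"
    using carr c(1) by (simp flip: m_assoc)
  then have "w = (inv c \<otimes> x \<otimes> c) \<otimes> (inv c \<otimes> y \<otimes> c)"
    using carr c xy by (simp add: m_assoc)
  moreover have "inv c \<otimes> x \<otimes> c \<in> conj_class G a" "inv c \<otimes> y \<otimes> c \<in> conj_class G b"
    using c(1) conj_class_mono[OF a xy(1)] conj_class_mono[OF b xy(2)]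
    unfolding conj_class_def by blast+
  ultimately show "w \<in> conj_class G a <#> conj_class G b"
    unfolding set_mult_def by blast
qed

end

end

theory Submission
  imports Defs
begin

text \<open>
  A scalar factor only translates a class by a central element, so the product is a single class.
  The substance lies in the lower bound for two non-scalar matrices \<open>A\<close> and \<open>B\<close>. Matrices with
  different traces are not conjugate, so it is enough to find many traces in the product of the two
  classes, and, where these do not suffice, to split one trace into several classes.

  Suppose first that \<open>A\<close> or \<open>B\<close> has trace different from \<open>2\<close> and \<open>-2\<close>. Products of classes
  commute, so let it be \<open>A\<close>. Every matrix of determinant \<open>1\<close> with the trace of \<open>A\<close> is conjugate
  to \<open>A\<close> (\<open>conj_class_regular\<close>). Fix a scaled companion matrix of \<open>B\<close> and let the other factor
  range over all matrices of determinant \<open>1\<close> and trace \<open>tr A\<close>: prescribing the trace \<open>\<tau>\<close> of the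
  product cuts a plane conic out of a quadric surface. It has a point unless, possibly,
  \<open>\<tau> = tr A * tr B / 2\<close> (\<open>traces_of_product_regular\<close>). This gives at least \<open>q - 1\<close> classes, which
  is enough since an odd \<open>q > 3\<close> is at least \<open>5\<close>.

  Suppose now that both traces are \<open>2\<close> or \<open>-2\<close>. Then \<open>A\<close> and \<open>B\<close> are conjugate to triangular
  matrices with constant diagonals \<open>e\<close> and \<open>f\<close> and nonzero corners \<open>x\<close> and \<open>y\<close>. Multiplying the
  first by lower triangular conjugates of the second gives the \<open>(q - 1) / 2\<close> traces
  \<open>2 * e * f - x * y * r\<^sup>2\<close> with \<open>r \<noteq> 0\<close>. Upper triangular conjugates give
  trace \<open>2 * e * f\<close> and the corners \<open>f * x + e * y * r\<^sup>2\<close>. The class of such a triangular product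
  determines its corner up to nonzero squares, and the corners do not all agree up to nonzero
  squares (\<open>shifted_squares_not_in_one_square_class\<close>). So the trace \<open>2 * e * f\<close> carries two classes,
  and there are at least \<open>(q - 1) / 2 + 2 = (q + 3) / 2\<close> classes (\<open>card_classes_parabolic\<close>).
\<close>

section \<open>Squares and conics over a finite field of odd characteristic\<close>

text \<open>Translation by \<open>1\<close> permutes the ring, so it leaves the sum of all elements unchanged.\<close>

lemma of_nat_card_UNIV_eq_0: "of_nat CARD('a::{ring_1,finite}) = (0::'a)"
proof -
  have "(\<Sum>x\<in>(UNIV::'a set). x + 1) = (\<Sum>x\<in>UNIV. x)"
    by (rule sum.reindex_bij_witness[of _ "\<lambda>x. x - 1" "\<lambda>x. x + 1"]) auto
  then show ?thesis
    by (simp add: sum.distrib)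
qed

lemma two_neq_zero_if_odd_card:
  assumes "odd CARD('a::{field,finite})"
  shows "(2::'a) \<noteq> 0"
proof
  assume two: "(2::'a) = 0"
  obtain k where "CARD('a) = 2 * k + 1"
    using assms by (elim oddE)
  then show False
    using two of_nat_card_UNIV_eq_0[where 'a = 'a] by simp
qed

definition nonzero_squares :: "'a::field set" where
  "nonzero_squares = (\<lambda>x. x\<^sup>2) ` (- {0})"

lemma card_nonzero_squares:
  assumes two: "(2::'a::{field,finite}) \<noteq> 0"
  shows "2 * card (nonzero_squares :: 'a set) + 1 = CARD('a)"
proof -
  have fibre: "card {x. x\<^sup>2 = s} = 2" if "s \<in> nonzero_squares" for s :: 'a
  proof -
    from that obtain y where y: "y \<noteq> 0" "s = y\<^sup>2"
      by (auto simp: nonzero_squares_def)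
    have "{x. x\<^sup>2 = s} = {y, - y}"
      by (auto simp: y power2_eq_iff)
    moreover have "y \<noteq> - y"
    proof
      assume "y = - y"
      then have "2 * y = 0"
        by (metis add.right_inverse mult_2)
      then show False
        using two y by simp
    qed
    ultimately show ?thesis
      by simp
  qed
  have "(- {0} :: 'a set) = (\<Union>s\<in>nonzero_squares. {x. x\<^sup>2 = s})"
    by (auto simp: nonzero_squares_def)
  then have "card (- {0} :: 'a set) = (\<Sum>s\<in>(nonzero_squares :: 'a set). card {x. x\<^sup>2 = s})"
    by (simp only:) (rule card_UN_disjoint, auto)
  also have "\<dots> = 2 * card (nonzero_squares :: 'a set)"
    by (simp add: fibre)
  finally show ?thesis
    by (simp add: card_Diff_singleton Compl_eq_Diff_UNIV)
      (metis One_nat_def Suc_pred' finite zero_less_card_finite)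
qed

text \<open>
  Multiplication by a square \<open>r\<^sup>2\<close> permutes the nonzero squares, hence fixes their sum. As soon as
  there is a nonzero square other than \<open>1\<close>, the sum must vanish. Over the field with three elements
  there is none, and the sum is \<open>1\<close>.
\<close>

lemma sum_nonzero_squares:
  assumes "(2::'a::{field,finite}) \<noteq> 0" and "CARD('a) > 3"
  shows "\<Sum>(nonzero_squares :: 'a set) = 0"
proof -
  have "card (nonzero_squares :: 'a set) \<ge> 2"
    using card_nonzero_squares[OF assms(1)] assms(2) by linarith
  then have "\<not> (nonzero_squares :: 'a set) \<subseteq> {1}"
    by (metis card_mono finite.emptyI finite_insert is_singletonI is_singleton_altdef
        not_less_eq_eq numeral_2_eq_2 One_nat_def)
  then obtain r :: 'a where r: "r \<noteq> 0" "r\<^sup>2 \<noteq> 1"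
    by (auto simp: nonzero_squares_def)
  have "(\<Sum>s\<in>nonzero_squares. r\<^sup>2 * s) = \<Sum>(nonzero_squares :: 'a set)"
  proof (rule sum.reindex_bij_witness[of _ "\<lambda>s. s / r\<^sup>2" "\<lambda>s. r\<^sup>2 * s"])
    show "r\<^sup>2 * s \<in> nonzero_squares" if "s \<in> nonzero_squares" for s
      using that r by (auto simp: nonzero_squares_def intro!: image_eqI[of _ _ "r * _"]
          simp: power_mult_distrib)
    show "s / r\<^sup>2 \<in> nonzero_squares" if "s \<in> nonzero_squares" for s
      using that r by (auto simp: nonzero_squares_def intro!: image_eqI[of _ _ "_ / r"]
          simp: power_divide)
  qed (use r in auto)
  then have "(r\<^sup>2 - 1) * \<Sum>(nonzero_squares :: 'a set) = 0"
    by (simp add: left_diff_distrib flip: sum_distrib_left)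
  then show ?thesis
    using r(2) by (metis eq_iff_diff_eq_0 mult_eq_0_iff)
qed

text \<open>
  The elements \<open>a + b * s\<close>, for \<open>s\<close> a nonzero square, are as many as the nonzero squares, so if
  they lay in \<open>v\<close> times the nonzero squares, they would exhaust that set. But the sum over the
  former is \<open>a\<close> times the number \<open>(q - 1) / 2\<close> of terms, that is \<open>-a / 2 \<noteq> 0\<close>, and the
  sum over the latter is \<open>0\<close>.
\<close>

lemma shifted_squares_not_in_one_square_class:
  fixes a b v :: "'a::{field,finite}"
  assumes two: "(2::'a) \<noteq> 0" and card: "CARD('a) > 3" and ab: "a \<noteq> 0" "b \<noteq> 0"
  shows "\<exists>s\<in>nonzero_squares. a + b * s \<notin> (\<lambda>s. v * s) ` nonzero_squares"
proof (rule ccontr)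
  let ?S = "nonzero_squares :: 'a set"
  assume "\<not> ?thesis"
  then have sub: "(\<lambda>s. a + b * s) ` ?S \<subseteq> (\<lambda>s. v * s) ` ?S"
    by blast
  have "card ((\<lambda>s. v * s) ` ?S) \<le> card ?S"
    by (simp add: card_image_le)
  also have inj: "inj_on (\<lambda>s. a + b * s) ?S"
    using ab by (auto simp: inj_on_def)
  then have "card ?S = card ((\<lambda>s. a + b * s) ` ?S)"
    by (simp add: card_image)
  finally have eq: "(\<lambda>s. a + b * s) ` ?S = (\<lambda>s. v * s) ` ?S"
    using sub by (simp add: card_seteq)
  have z: "\<Sum>?S = 0"
    using two card by (rule sum_nonzero_squares)
  have "\<Sum>((\<lambda>s. v * s) ` ?S) = 0"
  proof (cases "v = 0")
    case True
    then show ?thesis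
      by (auto intro: sum.neutral)
  next
    case False
    then have "\<Sum>((\<lambda>s. v * s) ` ?S) = (\<Sum>s\<in>?S. v * s)"
      by (subst sum.reindex) (auto simp: inj_on_def)
    then show ?thesis
      by (simp add: z flip: sum_distrib_left)
  qed
  moreover have "\<Sum>((\<lambda>s. a + b * s) ` ?S) = of_nat (card ?S) * a"
    using inj by (simp add: sum.reindex sum.distrib z flip: sum_distrib_left)
  ultimately have c0: "of_nat (card ?S) = (0::'a)"
    using eq ab by simp
  \<comment> \<open>The number of nonzero squares is \<open>-1/2\<close> in the field, hence not zero.\<close>
  have "of_nat (2 * card ?S + 1) = (0::'a)"
    by (simp only: card_nonzero_squares[OF two] of_nat_card_UNIV_eq_0)
  then show False
    using c0 by simp
qed

text \<open>
  Pigeonhole: \<open>a * x\<^sup>2\<close> and \<open>e - b * y\<^sup>2\<close> each take \<open>(q + 1) / 2\<close> values, so they share one.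
\<close>

lemma diagonal_form_universal:
  fixes a b e :: "'a::{field,finite}"
  assumes two: "(2::'a) \<noteq> 0" and ab: "a \<noteq> 0" "b \<noteq> 0"
  shows "\<exists>x y. a * x\<^sup>2 + b * y\<^sup>2 = e"
proof (rule ccontr)
  let ?Q = "insert 0 nonzero_squares :: 'a set"
  assume no: "\<not> ?thesis"
  have Q: "?Q = range (\<lambda>x. x\<^sup>2)"
    by (auto simp: nonzero_squares_def)
  have "2 * card ?Q = CARD('a) + 1"
    using card_nonzero_squares[OF two] by (simp add: nonzero_squares_def image_iff)
  moreover have "card ((\<lambda>s. a * s) ` ?Q) = card ?Q" "card ((\<lambda>s. e - b * s) ` ?Q) = card ?Q"
    using ab by (intro card_image; simp add: inj_on_def)+
  moreover have "(\<lambda>s. a * s) ` ?Q \<inter> (\<lambda>s. e - b * s) ` ?Q = {}"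
    using no unfolding Q by (auto simp: image_iff eq_diff_eq)
  then have "card ((\<lambda>s. a * s) ` ?Q \<union> (\<lambda>s. e - b * s) ` ?Q)
      = card ((\<lambda>s. a * s) ` ?Q) + card ((\<lambda>s. e - b * s) ` ?Q)"
    by (rule card_Un_disjoint[rotated 2]) auto
  moreover have "card ((\<lambda>s. a * s) ` ?Q \<union> (\<lambda>s. e - b * s) ` ?Q) \<le> CARD('a)"
    by (rule card_mono) auto
  ultimately show False
    by linarith
qed

text \<open>
  A conic with \<open>k \<noteq> 0\<close> becomes a diagonal form after completing the square in \<open>z\<close>; a parabola is
  the graph of a function of \<open>x\<close>.
\<close>

lemma conic_has_point:
  fixes k l n :: "'a::{field,finite}"
  assumes two: "(2::'a) \<noteq> 0" and "k \<noteq> 0 \<or> l \<noteq> 0"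
  shows "\<exists>x z. x\<^sup>2 + k * z\<^sup>2 + l * z + n = 0"
proof (cases "k = 0")
  case True
  then have "0\<^sup>2 + k * (- n / l)\<^sup>2 + l * (- n / l) + n = 0"
    using assms by simp
  then show ?thesis
    by blast
next
  case False
  then obtain x y where xy: "1 * x\<^sup>2 + k * y\<^sup>2 = l\<^sup>2 / (4 * k) - n"
    using diagonal_form_universal[OF two, of 1 k "l\<^sup>2 / (4 * k) - n"] by auto
  have four: "(4::'a) \<noteq> 0"
    using two by (metis mult_2 mult_eq_0_iff numeral_Bit0)
  define h where "h = l / (2 * k)"
  have h: "l = 2 * k * h" "l\<^sup>2 / (4 * k) = k * h\<^sup>2"
    using two four False by (simp_all add: h_def power2_eq_square)
  have "x\<^sup>2 + k * (y - h)\<^sup>2 + l * (y - h) + n = 0"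
    using xy unfolding h(2) unfolding h(1) by (simp add: power2_eq_square algebra_simps)
  then show ?thesis
    by blast
qed

text \<open>
  If \<open>a \<noteq> 0\<close>, completing the square gives a diagonal form; if \<open>a = 0\<close>, then \<open>b \<noteq> 0\<close> and the
  equation is linear in \<open>x\<close>.
\<close>

lemma binary_form_universal:
  fixes a b c e :: "'a::{field,finite}"
  assumes two: "(2::'a) \<noteq> 0" and disc: "b\<^sup>2 - 4 * a * c \<noteq> 0"
  shows "\<exists>x y. a * x\<^sup>2 + b * x * y + c * y\<^sup>2 = e"
proof (cases "a = 0")
  case True
  then have "a * ((e - c) / b)\<^sup>2 + b * ((e - c) / b) * 1 + c * 1\<^sup>2 = e"
    using disc by simp
  then show ?thesis
    by blast
next
  case False
  define h where "h = b / (2 * a)"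
  have h: "b = 2 * a * h"
    using two False by (simp add: h_def)
  have "b\<^sup>2 - 4 * a * c = - 4 * a * (c - a * h\<^sup>2)"
    unfolding h by (simp add: power2_eq_square algebra_simps)
  then have "c - a * h\<^sup>2 \<noteq> 0"
    using disc by auto
  then obtain u y where "a * u\<^sup>2 + (c - a * h\<^sup>2) * y\<^sup>2 = e"
    using diagonal_form_universal[OF two False] by blast
  then have "a * (u - h * y)\<^sup>2 + b * (u - h * y) * y + c * y\<^sup>2 = e"
    unfolding h by (simp add: power2_eq_square algebra_simps)
  then show ?thesis
    by blast
qed

section \<open>Conjugacy in SL(2) by explicit matrices\<close>

text \<open>Writing matrices by their entries turns all matrix identities below into polynomial ones.\<close>

definition mat2 :: "'a \<Rightarrow> 'a \<Rightarrow> 'a \<Rightarrow> 'a \<Rightarrow> 'a::zero ^ 2 ^ 2" where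
  "mat2 a b c d = vector [vector [a, b], vector [c, d]]"

lemma mat2_cases:
  obtains a b c d where "A = mat2 a b c d"
proof
  show "A = mat2 (A$1$1) (A$1$2) (A$2$1) (A$2$2)"
    by (simp add: mat2_def vec_eq_iff forall_2 vector_2)
qed

lemma mat2_eq_iff: "mat2 a b c d = mat2 a' b' c' d' \<longleftrightarrow> a = a' \<and> b = b' \<and> c = c' \<and> d = d'"
  by (auto simp: mat2_def vec_eq_iff forall_2 vector_2)

lemma mat2_mult:
  fixes a b c d :: "'a::comm_ring_1"
  shows "mat2 a b c d ** mat2 a' b' c' d'
    = mat2 (a * a' + b * c') (a * b' + b * d') (c * a' + d * c') (c * b' + d * d')"
  by (simp add: mat2_def matrix_matrix_mult_def vec_eq_iff forall_2 vector_2 sum_2)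

lemma det_mat2: "det (mat2 a b c d) = a * d - b * (c::'a::comm_ring_1)"
  by (simp add: mat2_def det_2 vector_2)

lemma trace_mat2: "trace (mat2 a b c d) = a + (d::'a::comm_ring_1)"
  by (simp add: mat2_def trace_def sum_2 vector_2)

lemma mat_eq_mat2: "mat c = mat2 c 0 0 c"
  by (simp add: mat2_def mat_def vec_eq_iff forall_2 vector_2)

lemmas mat2_simps = mat2_eq_iff mat2_mult det_mat2 trace_mat2 mat_eq_mat2

lemma carrier_SL2 [simp]: "A \<in> carrier SL2 \<longleftrightarrow> det A = 1"
  by (simp add: SL2_def)

lemma mult_SL2 [simp]: "A \<otimes>\<^bsub>SL2\<^esub> B = A ** B"
  by (simp add: SL2_def)

interpretation SL2: group "SL2 :: ('a::field ^ 2 ^ 2) monoid"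
  by (rule group_SL2)

text \<open>
  This form of conjugacy involves no inverse, so that it can be checked entry by entry.
\<close>

lemma conj_class_SL2_iff:
  fixes A X :: "'a::field ^ 2 ^ 2"
  assumes A: "det A = 1"
  shows "X \<in> conj_class SL2 A \<longleftrightarrow> (\<exists>P. det P = 1 \<and> P ** X = A ** P)"
proof -
  have *: "X = inv\<^bsub>SL2\<^esub> P \<otimes>\<^bsub>SL2\<^esub> A \<otimes>\<^bsub>SL2\<^esub> P \<longleftrightarrow> P ** X = A ** P" if P: "det P = 1" for P
  proof
    have cP: "P \<in> carrier SL2" "A \<in> carrier SL2"
      using P A by auto
    show "P ** X = A ** P" if "X = inv\<^bsub>SL2\<^esub> P \<otimes>\<^bsub>SL2\<^esub> A \<otimes>\<^bsub>SL2\<^esub> P"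
    proof -
      have "P \<otimes>\<^bsub>SL2\<^esub> X = A \<otimes>\<^bsub>SL2\<^esub> P"
        unfolding that using cP by (simp flip: SL2.m_assoc del: carrier_SL2 mult_SL2)
      then show ?thesis
        by simp
    qed
    assume eq: "P ** X = A ** P"
    then have "det P * det X = det A * det P"
      by (metis det_mul)
    then have "det X = 1"
      using P A by simp
    then have "X \<in> carrier SL2"
      by simp
    moreover have "A \<otimes>\<^bsub>SL2\<^esub> P = P \<otimes>\<^bsub>SL2\<^esub> X"
      using eq by simp
    ultimately show "X = inv\<^bsub>SL2\<^esub> P \<otimes>\<^bsub>SL2\<^esub> A \<otimes>\<^bsub>SL2\<^esub> P"
      using cP by (simp add: SL2.m_assoc del: carrier_SL2 mult_SL2)
        (simp flip: SL2.m_assoc del: carrier_SL2 mult_SL2)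
  qed
  show ?thesis
    unfolding conj_class_def using * by auto
qed

lemma trace_conj_class:
  fixes A X :: "'a::field ^ 2 ^ 2"
  assumes A: "det A = 1" and X: "X \<in> conj_class SL2 A"
  shows "trace X = trace A"
proof -
  obtain P where P: "det P = 1" "X = inv\<^bsub>SL2\<^esub> P \<otimes>\<^bsub>SL2\<^esub> A \<otimes>\<^bsub>SL2\<^esub> P"
    using X by (auto simp: conj_class_def)
  have "trace X = trace (P ** (inv\<^bsub>SL2\<^esub> P ** A))"
    using P(2) by (metis mult_SL2 trace_mul_sym)
  also have "P ** (inv\<^bsub>SL2\<^esub> P ** A) = P \<otimes>\<^bsub>SL2\<^esub> inv\<^bsub>SL2\<^esub> P \<otimes>\<^bsub>SL2\<^esub> A"
    by (simp add: matrix_mul_assoc)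
  also have "\<dots> = A"
    using P(1) A by (metis SL2.r_inv SL2.l_one carrier_SL2)
  finally show ?thesis .
qed

lemma trace_eq_if_conj_class_eq:
  fixes A B :: "'a::field ^ 2 ^ 2"
  assumes "det A = 1" "det B = 1" and "conj_class SL2 A = conj_class SL2 B"
  shows "trace A = trace B"
  using assms trace_conj_class[of B A] SL2.conj_class_self[of A] by simp

text \<open>
  If \<open>v = (x, y)\<close> is not an eigenvector, then \<open>v\<close> and \<open>A v / r\<close> form a basis of determinant \<open>1\<close>
  for exactly one \<open>r\<close>, namely \<open>r = det (v, A v)\<close>, the quadratic form of \<open>v\<close> below. In this
  basis \<open>A\<close> is the companion matrix of its characteristic polynomial with the off-diagonal entries
  scaled by \<open>r\<close> and \<open>1 / r\<close>. The factor \<open>r\<close> can only be removed over GL(2) in general, so it has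
  to be carried along.
\<close>

lemma companion_in_conj_class:
  fixes a b c d x y r :: "'a::field"
  assumes det: "a * d - b * c = 1"
    and r: "c * x\<^sup>2 + (d - a) * x * y - b * y\<^sup>2 = r" "r \<noteq> 0"
  shows "mat2 0 (- 1 / r) r (a + d) \<in> conj_class SL2 (mat2 a b c d)"
proof -
  let ?P = "mat2 x ((a * x + b * y) / r) y ((c * x + d * y) / r)"
  have "det ?P = (c * x\<^sup>2 + (d - a) * x * y - b * y\<^sup>2) / r"
    by (simp add: det_mat2 diff_divide_distrib add_divide_distrib power2_eq_square algebra_simps)
  then have "det ?P = 1"
    using r by simp
  moreover have "- x / r + (a * x + b * y) / r * (a + d)
      = a * ((a * x + b * y) / r) + b * ((c * x + d * y) / r)"
  proof -
    have "- x + (a * x + b * y) * (a + d) = a * (a * x + b * y) + b * (c * x + d * y)"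
      using det by algebra
    then show ?thesis
      using r(2) by (simp add: divide_simps)
  qed
  moreover have "- y / r + (c * x + d * y) / r * (a + d)
      = c * ((a * x + b * y) / r) + d * ((c * x + d * y) / r)"
  proof -
    have "- y + (c * x + d * y) * (a + d) = c * (a * x + b * y) + d * (c * x + d * y)"
      using det by algebra
    then show ?thesis
      using r(2) by (simp add: divide_simps)
  qed
  ultimately have eq: "?P ** mat2 0 (- 1 / r) r (a + d) = mat2 a b c d ** ?P"
    using r(2) by (simp add: mat2_simps)
  have "det (mat2 a b c d) = 1"
    using det by (simp add: det_mat2)
  from conj_class_SL2_iff[OF this] show ?thesis
    using \<open>det ?P = 1\<close> eq by blast
qed

text \<open>A matrix for which every vector is an eigenvector is scalar.\<close>

lemma nonscalar_conj_companion:
  fixes A :: "'a::field ^ 2 ^ 2"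
  assumes det: "det A = 1" and ns: "\<nexists>c. A = mat c"
  obtains r where "r \<noteq> 0" "mat2 0 (- 1 / r) r (trace A) \<in> conj_class SL2 A"
proof -
  obtain a b c d where A: "A = mat2 a b c d"
    by (rule mat2_cases)
  have "\<exists>x y. c * x\<^sup>2 + (d - a) * x * y - b * y\<^sup>2 \<noteq> 0"
  proof (rule ccontr)
    assume "\<not> ?thesis"
    then have *: "c * x\<^sup>2 + (d - a) * x * y - b * y\<^sup>2 = 0" for x y
      by blast
    have "c = 0" "b = 0" "d = a"
      using *[of 1 0] *[of 0 1] *[of 1 1] by auto
    then show False
      using ns by (auto simp: A mat2_simps)
  qed
  then obtain x y where "c * x\<^sup>2 + (d - a) * x * y - b * y\<^sup>2 \<noteq> 0"
    by blast
  moreover from this have "mat2 0 (- 1 / (c * x\<^sup>2 + (d - a) * x * y - b * y\<^sup>2))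
      (c * x\<^sup>2 + (d - a) * x * y - b * y\<^sup>2) (trace A) \<in> conj_class SL2 A"
    unfolding A trace_mat2 using det by (intro companion_in_conj_class) (auto simp: A det_mat2)
  ultimately show thesis
    by (rule that)
qed

text \<open>
  The quadratic form \<open>det (v, A v)\<close> has discriminant \<open>(tr A)\<^sup>2 - 4\<close>. If this is nonzero, the form
  takes the value \<open>1\<close>, and \<open>A\<close> is conjugate within SL(2) to the companion matrix itself, which
  depends only on the trace.
\<close>

lemma conj_class_regular:
  fixes A X :: "'a::{field,finite} ^ 2 ^ 2"
  assumes two: "(2::'a) \<noteq> 0" and A: "det A = 1" "(trace A)\<^sup>2 \<noteq> 4"
    and X: "det X = 1" "trace X = trace A"
  shows "X \<in> conj_class SL2 A"
proof -
  have comp: "mat2 0 (- 1) 1 (trace Y) \<in> conj_class SL2 Y"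
    if Y: "det Y = 1" "(trace Y)\<^sup>2 \<noteq> 4" for Y :: "'a ^ 2 ^ 2"
  proof -
    obtain a b c d where Yeq: "Y = mat2 a b c d"
      by (rule mat2_cases)
    have d1: "a * d - b * c = 1"
      using Y(1) by (simp add: Yeq det_mat2)
    have "(d - a)\<^sup>2 - 4 * c * (- b) = (a + d)\<^sup>2 - 4"
      using d1 by algebra
    then have "(d - a)\<^sup>2 - 4 * c * (- b) \<noteq> 0"
      using Y(2) by (simp add: Yeq trace_mat2)
    then obtain x y where "c * x\<^sup>2 + (d - a) * x * y + (- b) * y\<^sup>2 = 1"
      using binary_form_universal[OF two] by blast
    then have "mat2 0 (- 1 / 1) 1 (a + d) \<in> conj_class SL2 (mat2 a b c d)"
      by (intro companion_in_conj_class[where x = x and y = y]) (use d1 in auto)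
    then show ?thesis
      by (simp add: Yeq trace_mat2)
  qed
  have "mat2 0 (- 1) 1 (trace A) \<in> conj_class SL2 A"
    "mat2 0 (- 1) 1 (trace A) \<in> conj_class SL2 X"
    using comp[of A] comp[of X] A X by simp_all
  then have "conj_class SL2 A = conj_class SL2 X"
    using SL2.conj_class_eq A(1) X(1) by (metis carrier_SL2)
  then show ?thesis
    using SL2.conj_class_self[of X] X by simp
qed

text \<open>The factors of \<open>x y = y (y\<^sup>-\<^sup>1 x y)\<close> change places at the price of a conjugation.\<close>

lemma (in group) conj_class_mult_commute:
  assumes "a \<in> carrier G" "b \<in> carrier G"
  shows "conj_class G a <#> conj_class G b = conj_class G b <#> conj_class G a"
proof -
  have sub: "conj_class G a <#> conj_class G b \<subseteq> conj_class G b <#> conj_class G a"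
    if "a \<in> carrier G" "b \<in> carrier G" for a b
  proof
    fix z assume "z \<in> conj_class G a <#> conj_class G b"
    then obtain x y where xy: "x \<in> conj_class G a" "y \<in> conj_class G b" "z = x \<otimes> y"
      by (auto simp: set_mult_def)
    have carr: "x \<in> carrier G" "y \<in> carrier G"
      using xy conj_class_closed that by blast+
    have "inv y \<otimes> x \<otimes> y \<in> conj_class G a"
      using conj_class_mono[OF that(1) xy(1)] carr unfolding conj_class_def by blast
    moreover have "z = y \<otimes> (inv y \<otimes> x \<otimes> y)"
      using carr xy(3) by (simp flip: m_assoc)
    ultimately show "z \<in> conj_class G b <#> conj_class G a"
      using xy(2) unfolding set_mult_def by blast
  qed
  show ?thesis
    using sub assms by blast
qed

section \<open>Products of two non-scalar classes\<close>

lemma card_image_le_if_determined: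
  assumes fin: "finite X" and det: "\<And>x y. x \<in> X \<Longrightarrow> y \<in> X \<Longrightarrow> g x = g y \<Longrightarrow> f x = f y"
  shows "card (f ` X) \<le> card (g ` X)"
proof (rule surj_card_le)
  show "finite (g ` X)"
    using fin by simp
  let ?h = "\<lambda>c. f (SOME x. x \<in> X \<and> g x = c)"
  have "f x = ?h (g x)" if "x \<in> X" for x
  proof -
    have "(SOME x'. x' \<in> X \<and> g x' = g x) \<in> X \<and> g (SOME x'. x' \<in> X \<and> g x' = g x) = g x"
      by (rule someI[of _ x]) (use that in simp)
    then show ?thesis
      using det[OF that] by simp
  qed
  then show "f ` X \<subseteq> ?h ` g ` X"
    by blast
qed

lemma card_traces_le_card_classes:
  fixes X :: "('a::{field,finite} ^ 2 ^ 2) set"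
  assumes X: "X \<subseteq> carrier SL2"
  shows "card (trace ` X) \<le> card (conj_class SL2 ` X)"
proof (rule card_image_le_if_determined)
  fix x y assume "x \<in> X" "y \<in> X" and eq: "conj_class SL2 x = conj_class SL2 y"
  then have "det x = 1" "det y = 1"
    using X by auto
  then show "trace x = trace y"
    using eq by (rule trace_eq_if_conj_class_eq)
qed simp

text \<open>
  With \<open>s = tr B\<close> and \<open>t = tr A\<close>, the trace condition allows \<open>y\<close> to be eliminated, and completing
  the square in \<open>x\<close> leaves the conic
  \<open>u\<^sup>2 + (1 - s\<^sup>2 / 4) z\<^sup>2 + (\<tau> - s t / 2) z + (1 - t\<^sup>2 / 4) = 0\<close>. Excluding \<open>\<tau> = s t / 2\<close> keeps the
  linear coefficient nonzero, so that a point exists even when \<open>s\<^sup>2 = 4\<close>. Thus \<open>B\<close> may have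
  any trace.
\<close>

lemma traces_of_product_regular:
  fixes A B :: "'a::{field,finite} ^ 2 ^ 2"
  assumes two: "(2::'a) \<noteq> 0" and A: "det A = 1" "(trace A)\<^sup>2 \<noteq> 4"
    and B: "det B = 1" "\<nexists>c. B = mat c"
  shows "- {trace A * trace B / 2}
    \<subseteq> trace ` (conj_class SL2 A <#>\<^bsub>SL2\<^esub> conj_class SL2 B)"
proof
  fix \<tau> :: 'a
  define s t where "s = trace B" and "t = trace A"
  assume "\<tau> \<in> - {trace A * trace B / 2}"
  then have \<tau>: "\<tau> - s * t / 2 \<noteq> 0"
    by (simp add: s_def t_def mult.commute)
  obtain r where r: "r \<noteq> 0" "mat2 0 (- 1 / r) r s \<in> conj_class SL2 B"
    using nonscalar_conj_companion[OF B] unfolding s_def by blast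
  obtain u z where uz: "u\<^sup>2 + (1 - (s / 2)\<^sup>2) * z\<^sup>2 + (\<tau> - s * t / 2) * z + (1 - (t / 2)\<^sup>2) = 0"
    using conic_has_point[OF two] \<tau> by blast
  define x where "x = u - s / 2 * z + t / 2"
  define y where "y = z + s * x + \<tau> - s * t"
  define s' t' where "s' = s / 2" and "t' = t / 2"
  have st: "s = 2 * s'" "t = 2 * t'" "s * t / 2 = 2 * s' * t'"
    using two by (simp_all add: s'_def t'_def)
  have *: "x * (t - x) - y * z = 1"
    using uz unfolding y_def x_def st(3) unfolding s'_def[symmetric] t'_def[symmetric]
    unfolding st(1,2) by algebra
  \<comment> \<open>The off-diagonal scaling by \<open>r\<close> cancels that of the companion matrix of \<open>B\<close> in the trace.\<close>
  define A' where "A' = mat2 x (y / r) (r * z) (t - x)"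
  have "A' \<in> conj_class SL2 A"
    using two A by (rule conj_class_regular) (use * r(1) in \<open>simp_all add: A'_def mat2_simps t_def\<close>)
  then have "A' ** mat2 0 (- 1 / r) r s \<in> conj_class SL2 A <#>\<^bsub>SL2\<^esub> conj_class SL2 B"
    using r(2) unfolding set_mult_def by auto
  moreover have "trace (A' ** mat2 0 (- 1 / r) r s) = y - z + (t - x) * s"
    using r(1) by (simp add: A'_def mat2_simps)
  then have "trace (A' ** mat2 0 (- 1 / r) r s) = \<tau>"
    by (simp add: y_def algebra_simps)
  ultimately show "\<tau> \<in> trace ` (conj_class SL2 A <#>\<^bsub>SL2\<^esub> conj_class SL2 B)"
    by (rule rev_image_eqI[OF _ sym])
qed

lemma set_mult_conj_classes_subset:
  fixes A B :: "'a::field ^ 2 ^ 2"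
  assumes "det A = 1" "det B = 1"
  shows "conj_class SL2 A <#>\<^bsub>SL2\<^esub> conj_class SL2 B \<subseteq> carrier SL2"
  using assms by (intro SL2.set_mult_closed SL2.conj_class_closed) auto

lemma card_classes_regular:
  fixes A B :: "'a::{field,finite} ^ 2 ^ 2"
  assumes two: "(2::'a) \<noteq> 0" and A: "det A = 1" "(trace A)\<^sup>2 \<noteq> 4"
    and B: "det B = 1" "\<nexists>c. B = mat c"
  shows "card (conj_class SL2 ` (conj_class SL2 A <#>\<^bsub>SL2\<^esub> conj_class SL2 B)) \<ge> CARD('a) - 1"
proof -
  let ?X = "conj_class SL2 A <#>\<^bsub>SL2\<^esub> conj_class SL2 B"
  have "CARD('a) - 1 = card (- {trace A * trace B / 2})"
    by (simp add: Compl_eq_Diff_UNIV)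
  also have "\<dots> \<le> card (trace ` ?X)"
    by (rule card_mono[OF finite traces_of_product_regular[OF assms]])
  also have "\<dots> \<le> card (conj_class SL2 ` ?X)"
    by (rule card_traces_le_card_classes[OF set_mult_conj_classes_subset[OF A(1) B(1)]])
  finally show ?thesis .
qed

text \<open>
  When \<open>(tr A)\<^sup>2 = 4\<close>, the only eigenvalue is \<open>e = tr A / 2\<close>, with \<open>e\<^sup>2 = 1\<close>. The scaled companion
  matrix has eigenvector \<open>(1, - e r)\<close>, the first column of the conjugating matrix below.
\<close>

lemma nonscalar_conj_triangular:
  fixes A :: "'a::field ^ 2 ^ 2"
  assumes two: "(2::'a) \<noteq> 0" and A: "det A = 1" "(trace A)\<^sup>2 = 4" and ns: "\<nexists>c. A = mat c"
  obtains e x where "e\<^sup>2 = 1" "x \<noteq> 0" "mat2 e x 0 e \<in> conj_class SL2 A"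
proof -
  define e where "e = trace A / 2"
  have tr: "trace A = 2 * e"
    using two by (simp add: e_def)
  have four: "(4::'a) \<noteq> 0"
    using two by (metis mult_2 mult_eq_0_iff numeral_Bit0)
  have "4 * e\<^sup>2 = 4"
    using A(2) by (simp add: tr power_mult_distrib)
  then have e: "e\<^sup>2 = 1"
    using four by simp
  then have ee: "e * (e * r) = r" for r
    by (simp add: power2_eq_square flip: mult.assoc)
  obtain r where r: "r \<noteq> 0" "mat2 0 (- 1 / r) r (2 * e) \<in> conj_class SL2 A"
    using nonscalar_conj_companion[OF A(1) ns] unfolding tr by blast
  have detC: "det (mat2 0 (- 1 / r) r (2 * e)) = 1"
    using r(1) by (simp add: det_mat2)
  let ?P = "mat2 1 0 (- (e * r)) 1"
  have "det ?P = 1"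
    by (simp add: det_mat2)
  moreover have "?P ** mat2 e (- 1 / r) 0 e = mat2 0 (- 1 / r) r (2 * e) ** ?P"
    using r(1) ee ee[of 1] by (simp add: mat2_mult mat2_eq_iff algebra_simps)
  ultimately have "mat2 e (- 1 / r) 0 e \<in> conj_class SL2 (mat2 0 (- 1 / r) r (2 * e))"
    using conj_class_SL2_iff[OF detC] by blast
  then have "mat2 e (- 1 / r) 0 e \<in> conj_class SL2 A"
    using SL2.conj_class_mono[OF _ r(2)] A(1) by auto
  then show thesis
    by (rule that[OF e, rotated]) (use r(1) in simp)
qed

text \<open>
  Let \<open>(p, q)\<close> and \<open>(r, s)\<close> be the rows of a conjugating matrix. If \<open>r = 0\<close>, it is triangular with
  diagonal \<open>1 / s\<close>, \<open>s\<close> and multiplies the corner by \<open>s\<^sup>2\<close>. If \<open>r \<noteq> 0\<close>, both corners must vanish.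
\<close>

lemma triangular_conj_imp_square_ratio:
  fixes e x y :: "'a::field"
  assumes e: "e\<^sup>2 = 1" and conj: "mat2 e x 0 e \<in> conj_class SL2 (mat2 e y 0 e)"
  shows "x \<in> (\<lambda>s. y * s) ` nonzero_squares"
proof -
  have "det (mat2 e y 0 e) = 1"
    using e by (simp add: det_mat2 power2_eq_square)
  then obtain P where P: "det P = 1" "P ** mat2 e x 0 e = mat2 e y 0 e ** P"
    using conj by (auto simp: conj_class_SL2_iff)
  obtain p q r s where Peq: "P = mat2 p q r s"
    by (rule mat2_cases)
  have *: "y * r = 0" "p * x = y * s" "r * x = 0" "p * s - q * r = 1"
    using P by (auto simp: Peq mat2_simps algebra_simps)
  show ?thesis
  proof (cases "r = 0")
    case True
    then have ps: "p * s = 1"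
      using *(4) by simp
    then have "s \<noteq> 0"
      by auto
    moreover have "x = y * s\<^sup>2"
      using ps *(2) by algebra
    ultimately show ?thesis
      by (auto simp: nonzero_squares_def)
  next
    case False
    then have "x = y * 1\<^sup>2"
      using *(1,3) by simp
    then show ?thesis
      unfolding nonzero_squares_def by (intro image_eqI[of _ _ "1\<^sup>2"]) auto
  qed
qed

lemma card_classes_parabolic:
  fixes A B :: "'a::{field,finite} ^ 2 ^ 2"
  assumes two: "(2::'a) \<noteq> 0" and card: "CARD('a) > 3"
    and A: "det A = 1" "(trace A)\<^sup>2 = 4" "\<nexists>c. A = mat c"
    and B: "det B = 1" "(trace B)\<^sup>2 = 4" "\<nexists>c. B = mat c"
  shows "2 * card (conj_class SL2 ` (conj_class SL2 A <#>\<^bsub>SL2\<^esub> conj_class SL2 B)) \<ge> CARD('a) + 3"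
proof -
  let ?X = "conj_class SL2 A <#>\<^bsub>SL2\<^esub> conj_class SL2 B"
  have Xc: "?X \<subseteq> carrier SL2"
    using A(1) B(1) by (rule set_mult_conj_classes_subset)
  obtain e x where ex: "e\<^sup>2 = 1" "x \<noteq> 0" "mat2 e x 0 e \<in> conj_class SL2 A"
    using nonscalar_conj_triangular[OF two A] by blast
  obtain f y where fy: "f\<^sup>2 = 1" "y \<noteq> 0" "mat2 f y 0 f \<in> conj_class SL2 B"
    using nonscalar_conj_triangular[OF two B] by blast
  have ef: "e \<noteq> 0" "f \<noteq> 0" "(e * f)\<^sup>2 = 1"
    using ex fy by (auto simp: power_mult_distrib)
  have prod: "mat2 e x 0 e ** Y \<in> ?X" if "Y \<in> conj_class SL2 (mat2 f y 0 f)" for Y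
    using that ex(3) SL2.conj_class_mono[OF _ fy(3)] B(1) unfolding set_mult_def by auto
  have dB: "det (mat2 f y 0 f) = 1"
    using fy(1) by (simp add: det_mat2 power2_eq_square)
  \<comment> \<open>Split the product by trace: \<open>X1\<close> contributes \<open>(q - 1) / 2\<close> classes and \<open>X0\<close> two more.\<close>
  define X1 where "X1 = {Z \<in> ?X. trace Z \<noteq> 2 * (e * f)}"
  define X0 where "X0 = {Z \<in> ?X. trace Z = 2 * (e * f)}"
  have "(\<lambda>s. 2 * (e * f) - x * y * s) ` nonzero_squares \<subseteq> trace ` X1"
  proof safe
    fix s :: 'a assume "s \<in> nonzero_squares"
    then obtain r where r: "r \<noteq> 0" "s = r\<^sup>2"
      by (auto simp: nonzero_squares_def)
    have "mat2 f 0 (- (y * r\<^sup>2)) f \<in> conj_class SL2 (mat2 f y 0 f)"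
      unfolding conj_class_SL2_iff[OF dB]
      by (intro exI[of _ "mat2 0 (- 1 / r) r 0"])
        (use r in \<open>simp add: mat2_simps power2_eq_square\<close>)
    from prod[OF this]
    have "mat2 e x 0 e ** mat2 f 0 (- (y * r\<^sup>2)) f \<in> X1"
      "trace (mat2 e x 0 e ** mat2 f 0 (- (y * r\<^sup>2)) f) = 2 * (e * f) - x * y * s"
      using r ex(2) fy(2) by (simp_all add: X1_def mat2_simps)
    then show "2 * (e * f) - x * y * s \<in> trace ` X1"
      by (rule rev_image_eqI[OF _ sym])
  qed
  then have "card ((\<lambda>s. 2 * (e * f) - x * y * s) ` nonzero_squares) \<le> card (trace ` X1)"
    by (intro card_mono) auto
  moreover have "card ((\<lambda>s. 2 * (e * f) - x * y * s) ` nonzero_squares)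
      = card (nonzero_squares :: 'a set)"
    using ex(2) fy(2) by (intro card_image) (auto simp: inj_on_def)
  moreover have "card (trace ` X1) \<le> card (conj_class SL2 ` X1)"
    using Xc by (intro card_traces_le_card_classes) (auto simp: X1_def)
  ultimately have c1: "card (nonzero_squares :: 'a set) \<le> card (conj_class SL2 ` X1)"
    by simp
  have tri: "mat2 (e * f) (f * x + e * y * s) 0 (e * f) \<in> X0" if "s \<in> nonzero_squares" for s
  proof -
    from that obtain r where r: "r \<noteq> 0" "s = r\<^sup>2"
      by (auto simp: nonzero_squares_def)
    have "mat2 f (y * r\<^sup>2) 0 f \<in> conj_class SL2 (mat2 f y 0 f)"
      unfolding conj_class_SL2_iff[OF dB]
      by (intro exI[of _ "mat2 (1 / r) 0 0 r"])
        (use r in \<open>simp add: mat2_simps power2_eq_square\<close>)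
    from prod[OF this] show ?thesis
      by (simp add: X0_def mat2_simps r algebra_simps)
  qed
  have "1 \<in> (nonzero_squares :: 'a set)"
    by (auto simp: nonzero_squares_def image_iff intro!: bexI[of _ 1])
  \<comment> \<open>Compare the corner for the square \<open>1\<close> with one in a different square class.\<close>
  define v where "v = f * x + e * y * 1"
  obtain s where s: "s \<in> nonzero_squares" "f * x + e * y * s \<notin> (\<lambda>s. v * s) ` nonzero_squares"
    using shifted_squares_not_in_one_square_class[OF two card, of "f * x" "e * y" v] ef ex fy
    by auto
  let ?U = "mat2 (e * f) v 0 (e * f)" and ?V = "mat2 (e * f) (f * x + e * y * s) 0 (e * f)"
  have "?V \<notin> conj_class SL2 ?U"
    using triangular_conj_imp_square_ratio[OF ef(3)] s(2) by blast
  moreover have UV: "?U \<in> X0" "?V \<in> X0"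
    using tri[OF \<open>1 \<in> nonzero_squares\<close>] tri[OF s(1)] by (simp_all add: v_def)
  moreover have "?V \<in> conj_class SL2 ?V"
    using UV(2) Xc by (intro SL2.conj_class_self) (auto simp: X0_def)
  ultimately have "conj_class SL2 ?U \<noteq> conj_class SL2 ?V"
    by blast
  then have "2 = card {conj_class SL2 ?U, conj_class SL2 ?V}"
    by simp
  also have "\<dots> \<le> card (conj_class SL2 ` X0)"
    using UV by (intro card_mono) auto
  finally have c0: "2 \<le> card (conj_class SL2 ` X0)" .
  have disj: "conj_class SL2 ` X1 \<inter> conj_class SL2 ` X0 = {}"
  proof -
    have False if "Z \<in> X1" "W \<in> X0" "conj_class SL2 Z = conj_class SL2 W" for Z W
    proof -
      have "det Z = 1" "det W = 1"
        using that Xc by (auto simp: X0_def X1_def)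
      then have "trace Z = trace W"
        using that(3) by (rule trace_eq_if_conj_class_eq)
      then show False
        using that by (simp add: X0_def X1_def)
    qed
    then show ?thesis
      by blast
  qed
  have "?X = X1 \<union> X0"
    by (auto simp: X0_def X1_def)
  then have "card (conj_class SL2 ` ?X) = card (conj_class SL2 ` X1) + card (conj_class SL2 ` X0)"
    using disj by (simp add: image_Un card_Un_disjoint)
  then show ?thesis
    using c0 c1 card_nonzero_squares[OF two] by linarith
qed

section \<open>The dichotomy\<close>

lemma conj_class_scalar:
  fixes c :: "'a::field"
  assumes "det (mat c :: 'a ^ 2 ^ 2) = 1"
  shows "conj_class SL2 (mat c :: 'a ^ 2 ^ 2) = {mat c}"
proof -
  have "X = mat c" if "X \<in> conj_class SL2 (mat c)" for X :: "'a ^ 2 ^ 2"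
  proof -
    from that obtain P where P: "det P = 1" "X = inv\<^bsub>SL2\<^esub> P ** (mat c ** P)"
      by (auto simp: conj_class_def matrix_mul_assoc)
    have "mat c ** P = P ** mat c"
      by (rule mat2_cases[of P]) (simp add: mat2_simps mult.commute)
    then have "X = inv\<^bsub>SL2\<^esub> P \<otimes>\<^bsub>SL2\<^esub> P \<otimes>\<^bsub>SL2\<^esub> mat c"
      using P(2) by (simp add: matrix_mul_assoc)
    then show ?thesis
      using P(1) assms by (metis SL2.l_inv SL2.l_one carrier_SL2)
  qed
  then show ?thesis
    using SL2.conj_class_self[of "mat c"] assms by auto
qed

lemma scalar_class_mult:
  fixes B :: "'a::field ^ 2 ^ 2"
  assumes c: "det (mat c :: 'a ^ 2 ^ 2) = 1" and B: "det B = 1"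
  shows "conj_class SL2 (mat c) <#>\<^bsub>SL2\<^esub> conj_class SL2 B = conj_class SL2 (mat c ** B)"
proof -
  have comm: "P ** mat c = mat c ** P" for P :: "'a ^ 2 ^ 2"
    by (rule mat2_cases[of P]) (simp add: mat2_simps mult.commute)
  have conj: "inv\<^bsub>SL2\<^esub> P ** (mat c ** B) ** P = mat c ** (inv\<^bsub>SL2\<^esub> P ** B ** P)" for P
    by (metis comm matrix_mul_assoc)
  show ?thesis
    unfolding conj_class_scalar[OF c] unfolding conj_class_def set_mult_def by (auto simp: conj)
qed

theorem theoremB:
  fixes p m q :: nat
    and A B :: "'a::{field,finite} ^ 2 ^ 2"
  assumes "prime p" and "odd p" and "m > 0" and "q = p ^ m" and "q > 3"
    and "CARD('a) = q"
    and "A \<in> carrier SL2" and "B \<in> carrier SL2"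
  shows
    "(conj_class SL2 A <#>\<^bsub>SL2\<^esub> conj_class SL2 B = conj_class SL2 (A \<otimes>\<^bsub>SL2\<^esub> B)
        \<and> ((\<exists>c. A = mat c) \<or> (\<exists>c. B = mat c)))
     \<noteq> (real (eta SL2 (conj_class SL2 A <#>\<^bsub>SL2\<^esub> conj_class SL2 B)) \<ge> (real q + 3) / 2)"
proof -
  let ?X = "conj_class SL2 A <#>\<^bsub>SL2\<^esub> conj_class SL2 B"
  have two: "(2::'a) \<noteq> 0"
    using assms by (intro two_neq_zero_if_odd_card) simp
  have q3: "CARD('a) > 3"
    using assms by simp
  have A: "det A = 1" and B: "det B = 1"
    using assms by auto
  have eta: "eta SL2 ?X = card (conj_class SL2 ` ?X)"
    using assms by (intro SL2.eta_eq SL2.conj_invariant_set_mult)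
  have comm: "?X = conj_class SL2 B <#>\<^bsub>SL2\<^esub> conj_class SL2 A"
    using assms by (intro SL2.conj_class_mult_commute)
  show ?thesis
  proof (cases "(\<exists>c. A = mat c) \<or> (\<exists>c. B = mat c)")
    case True
    have AB: "?X = conj_class SL2 (A ** B)"
    proof (cases "\<exists>c. A = mat c")
      case True
      then show ?thesis
        using scalar_class_mult A B by blast
    next
      case False
      with True obtain c where c: "B = mat c"
        by blast
      have "B ** A = A ** B"
        unfolding c by (rule mat2_cases[of A]) (simp add: mat2_simps mult.commute)
      then show ?thesis
        using scalar_class_mult[of c A] A B c comm by simp
    qed
    have "conj_class SL2 ` conj_class SL2 (A ** B) \<subseteq> {conj_class SL2 (A ** B)}"
      using SL2.conj_class_eq[of "A ** B"] A B by (auto simp: det_mul)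
    then have "card (conj_class SL2 ` ?X) \<le> 1"
      unfolding AB by (metis card.empty card_insert_if card_mono empty_iff finite.intros One_nat_def)
    then have "real (eta SL2 ?X) \<le> 1"
      by (simp add: eta)
    then have "\<not> (real q + 3) / 2 \<le> real (eta SL2 ?X)"
      by simp
    then show ?thesis
      using True AB unfolding mult_SL2 by blast
  next
    case False
    then have nsA: "\<nexists>c. A = mat c" and nsB: "\<nexists>c. B = mat c"
      by auto
    have "2 * card (conj_class SL2 ` ?X) \<ge> CARD('a) + 3"
    proof (cases "(trace A)\<^sup>2 = 4 \<and> (trace B)\<^sup>2 = 4")
      case True
      then show ?thesis
        using card_classes_parabolic[OF two q3 A _ nsA B _ nsB] by blast
    next
      case False
      then have "card (conj_class SL2 ` ?X) \<ge> CARD('a) - 1"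
        using card_classes_regular[OF two A _ B nsB] card_classes_regular[OF two B _ A nsA] comm
        by metis
      moreover have "CARD('a) \<noteq> 4"
        using assms by (metis even_numeral even_power)
      ultimately show ?thesis
        using q3 by linarith
    qed
    then have "real (q + 3) \<le> real (2 * eta SL2 ?X)"
      unfolding eta \<open>CARD('a) = q\<close> by (rule of_nat_mono)
    then have "(real q + 3) / 2 \<le> real (eta SL2 ?X)"
      by simp
    then show ?thesis
      using False by blast
  qed
qed

end
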